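(* Let $c_0$ be a positive integer, let $t\ge 4$ and let $k_1,\ldots,k_t\ge 1$ be integers. If $t>3(c_0+1)$, then $$\gamma_2(G(t;k_1,\ldots,k_t)) - a(G(t;k_1,\ldots,k_t)) > c_0+1.$$
   Context: All graphs are finite, simple and undirected. For a graph $G$ with $m(G)$ edges and non-decreasing degree sequence $d_1\le\cdots\le d_n$, the annihilation number $a(G)$ is the largest integer $k$ such that $\sum_{i=1}^k d_i\le m(G)$. The $2$-domination number $\gamma_2(G)$ is the minimum cardinality of a set $S\subseteq V(G)$ such that every vertex of $V(G)\setminus S$ is adjacent to at least two vertices of $S$. For $t\ge 4$ and $k_1,\ldots,k_t\ge 1$, the graph $G(t;k_1,\ldots,k_t)$ is constructed as follows: take a disjoint union of cycles $C_{3k_i+1}$, $i\in\{1,\ldots,t\}$, add a new vertex $w$, and join $w$ by an edge to one (arbitrary but fixed) vertex of each of these cycles; then, in the graph obtained so far, attach a new pendant vertex (a new vertex of degree $1$) to each vertex of degree $2$. *)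

theory Defs
  imports Main "HOL-Library.Multiset"
begin

record 'a ugraph =
  verts :: "'a set"
  edges :: "'a set set"

definition simple_graph :: "'a ugraph \<Rightarrow> bool" where
  "simple_graph G \<longleftrightarrow> finite (verts G) \<and> (\<forall>e\<in>edges G. e \<subseteq> verts G \<and> card e = 2)"

definition adj :: "'a ugraph \<Rightarrow> 'a \<Rightarrow> 'a \<Rightarrow> bool" where
  "adj G u v \<longleftrightarrow> {u, v} \<in> edges G"

definition degree :: "'a ugraph \<Rightarrow> 'a \<Rightarrow> nat" where
  "degree G v = card {u \<in> verts G. adj G v u}"

definition num_edges :: "'a ugraph \<Rightarrow> nat" where
  "num_edges G = card (edges G)"

definition degree_sequence :: "'a ugraph \<Rightarrow> nat list" where
  "degree_sequence G = sorted_list_of_multiset (image_mset (degree G) (mset_set (verts G)))"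

definition annihilation_number :: "'a ugraph \<Rightarrow> nat" where
  "annihilation_number G =
     Max {k. k \<le> length (degree_sequence G) \<and>
             sum_list (take k (degree_sequence G)) \<le> num_edges G}"

definition two_dominating :: "'a ugraph \<Rightarrow> 'a set \<Rightarrow> bool" where
  "two_dominating G S \<longleftrightarrow>
     S \<subseteq> verts G \<and> (\<forall>v \<in> verts G - S. card {u \<in> S. adj G v u} \<ge> 2)"

definition two_domination_number :: "'a ugraph \<Rightarrow> nat" where
  "two_domination_number G = Min (card ` {S. two_dominating G S})"

text \<open>Intended for \<open>n \<ge> 3\<close> only.\<close>
definition cycle_graph :: "nat \<Rightarrow> nat ugraph" where
  "cycle_graph n = \<lparr>verts = {..<n}, edges = {{j, Suc j mod n} | j. j < n}\<rparr>"

definition graph_disjoint_union :: "'i set \<Rightarrow> ('i \<Rightarrow> 'a ugraph) \<Rightarrow> ('i \<times> 'a) ugraph" where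
  "graph_disjoint_union I H =
     \<lparr>verts = (SIGMA i:I. verts (H i)),
      edges = (\<Union>i\<in>I. {Pair i ` e | e. e \<in> edges (H i)})\<rparr>"

text \<open>The new vertex is \<open>None\<close>; it is joined to the vertices in \<open>X\<close>.\<close>
definition add_vertex :: "'a set \<Rightarrow> 'a ugraph \<Rightarrow> 'a option ugraph" where
  "add_vertex X G =
     \<lparr>verts = insert None (Some ` verts G),
      edges = {Some ` e | e. e \<in> edges G} \<union> {{None, Some x} | x. x \<in> X}\<rparr>"

text \<open>\<open>Inl\<close> embeds the old vertices; \<open>Inr v\<close> is the pendant vertex attached to \<open>v\<close>.\<close>
definition attach_pendants :: "'a set \<Rightarrow> 'a ugraph \<Rightarrow> ('a + 'a) ugraph" where
  "attach_pendants X G =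
     \<lparr>verts = Inl ` verts G \<union> Inr ` X,
      edges = {Inl ` e | e. e \<in> edges G} \<union> {{Inl v, Inr v} | v. v \<in> X}\<rparr>"

text \<open>The argument \<open>r\<close> records the arbitrary choice of the vertex \<open>r i\<close> of the \<open>i\<close>-th cycle
  that is joined to \<open>w\<close>.\<close>
definition joined_cycles ::
  "nat \<Rightarrow> (nat \<Rightarrow> nat) \<Rightarrow> (nat \<Rightarrow> nat) \<Rightarrow> (nat \<times> nat) option ugraph" where
  "joined_cycles t k r =
     add_vertex {(i, r i) | i. i \<in> {1..t}}
       (graph_disjoint_union {1..t} (\<lambda>i. cycle_graph (3 * k i + 1)))"

definition pendant_cycles_graph ::
  "nat \<Rightarrow> (nat \<Rightarrow> nat) \<Rightarrow> (nat \<Rightarrow> nat) \<Rightarrow>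
     ((nat \<times> nat) option + (nat \<times> nat) option) ugraph" where
  "pendant_cycles_graph t k r =
     attach_pendants {v \<in> verts (joined_cycles t k r). degree (joined_cycles t k r) v = 2}
       (joined_cycles t k r)"

lemma simple_graph_cycle_graph:
  assumes "n \<ge> 3"
  shows "simple_graph (cycle_graph n)"
proof -
  have "j \<noteq> Suc j mod n" if "j < n" for j
    using assms that by (cases "Suc j = n") auto
  then show ?thesis
    using assms by (auto simp: simple_graph_def cycle_graph_def)
qed

lemma simple_graph_disjoint_union:
  assumes "finite I" "\<And>i. i \<in> I \<Longrightarrow> simple_graph (H i)"
  shows "simple_graph (graph_disjoint_union I H)"
  using assms
  by (auto simp: simple_graph_def graph_disjoint_union_def card_image inj_on_def)

lemma simple_graph_add_vertex:
  assumes "simple_graph G" "X \<subseteq> verts G"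
  shows "simple_graph (add_vertex X G)"
  using assms by (auto simp: simple_graph_def add_vertex_def card_image)

lemma simple_graph_attach_pendants:
  assumes "simple_graph G" "X \<subseteq> verts G"
  shows "simple_graph (attach_pendants X G)"
  using assms by (auto simp: simple_graph_def attach_pendants_def card_image intro: finite_subset)

lemma simple_graph_pendant_cycles_graph:
  assumes "\<And>i. i \<in> {1..t} \<Longrightarrow> k i \<ge> 1"
    and "\<And>i. i \<in> {1..t} \<Longrightarrow> r i \<in> verts (cycle_graph (3 * k i + 1))"
  shows "simple_graph (pendant_cycles_graph t k r)"
proof -
  have "simple_graph (cycle_graph (3 * k i + 1))" if "i \<in> {1..t}" for i
    using assms(1)[OF that] by (intro simple_graph_cycle_graph) simp
  then have "simple_graph (graph_disjoint_union {1..t} (\<lambda>i. cycle_graph (3 * k i + 1)))"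
    by (intro simple_graph_disjoint_union) simp_all
  then have "simple_graph (joined_cycles t k r)"
    unfolding joined_cycles_def using assms(2)
    by (intro simple_graph_add_vertex) (auto simp: graph_disjoint_union_def)
  then show ?thesis
    unfolding pendant_cycles_graph_def by (intro simple_graph_attach_pendants) auto
qed

end

theory Submission imports Defs begin

text \<open>Let \<open>L\<close> be the number of pendant vertices and \<open>K\<close> the sum of the \<open>k\<^sub>i\<close>. Every pendant
  vertex lies in each 2-dominating set. The pendant vertex or \<open>w\<close> supplies at most one of the two
  neighbours that a cycle vertex needs, so a 2-dominating set also meets each cycle
  \<open>C\<^bsub>3k+1\<^esub>\<close> in a dominating set of the cycle, which has at least \<open>k + 1\<close> elements;
  hence \<open>\<gamma>\<^sub>2 \<ge> L + K + t\<close>. All vertices other than the pendant ones have degree at least 3, so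
  \<open>3a - 2L \<le> m \<le> 3K + 2t + L\<close>. Together \<open>3(\<gamma>\<^sub>2 - a) \<ge> t\<close>, whatever the value of \<open>L\<close>.\<close>

section \<open>Vertex sets and adjacency of cycles and of the three graph operations\<close>

lemma adj_commute: "adj G u v \<longleftrightarrow> adj G v u"
  by (simp add: adj_def insert_commute)

lemma verts_cycle_graph: "verts (cycle_graph n) = {..<n}"
  by (simp add: cycle_graph_def)

lemma verts_graph_disjoint_union: "verts (graph_disjoint_union I H) = (SIGMA i:I. verts (H i))"
  by (simp add: graph_disjoint_union_def)

lemma verts_add_vertex: "verts (add_vertex X G) = insert None (Some ` verts G)"
  by (simp add: add_vertex_def)

lemma verts_attach_pendants: "verts (attach_pendants X G) = Inl ` verts G \<union> Inr ` X"
  by (simp add: attach_pendants_def)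

lemma adj_cycle_graph:
  "adj (cycle_graph n) u v \<longleftrightarrow> u < n \<and> v = Suc u mod n \<or> v < n \<and> u = Suc v mod n"
  by (auto simp: adj_def cycle_graph_def doubleton_eq_iff)

lemma adj_graph_disjoint_union:
  "adj (graph_disjoint_union I H) (i, u) (j, v) \<longleftrightarrow> i = j \<and> i \<in> I \<and> adj (H i) u v"
proof -
  have "{(i, u), (j, v)} = Pair l ` e \<longleftrightarrow> i = l \<and> j = l \<and> e = {u, v}" for l e
  proof
    assume eq: "{(i, u), (j, v)} = Pair l ` e"
    then have "(i, u) \<in> Pair l ` e" "(j, v) \<in> Pair l ` e" by blast+
    then have "i = l" "j = l" by auto
    with eq have "Pair l ` {u, v} = Pair l ` e" by simp
    then have "{u, v} = e" by (subst (asm) inj_image_eq_iff) (auto simp: inj_on_def)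
    with \<open>i = l\<close> \<open>j = l\<close> show "i = l \<and> j = l \<and> e = {u, v}" by simp
  qed auto
  then show ?thesis
    by (auto simp: adj_def graph_disjoint_union_def)
qed

lemma adj_add_vertex:
  "adj (add_vertex X G) (Some u) (Some v) \<longleftrightarrow> adj G u v"
  "adj (add_vertex X G) None (Some v) \<longleftrightarrow> v \<in> X"
  "adj (add_vertex X G) (Some v) None \<longleftrightarrow> v \<in> X"
  "\<not> adj (add_vertex X G) None None"
proof -
  have "{Some u, Some v} = Some ` e \<longleftrightarrow> e = {u, v}" for e
    using inj_image_eq_iff[of Some "{u, v}" e] by auto
  then show "adj (add_vertex X G) (Some u) (Some v) \<longleftrightarrow> adj G u v"
    by (auto simp: adj_def add_vertex_def)
  show "adj (add_vertex X G) None (Some v) \<longleftrightarrow> v \<in> X"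
    by (auto simp: adj_def add_vertex_def doubleton_eq_iff)
  then show "adj (add_vertex X G) (Some v) None \<longleftrightarrow> v \<in> X"
    by (simp add: adj_commute)
  show "\<not> adj (add_vertex X G) None None"
    by (auto simp: adj_def add_vertex_def)
qed

lemma adj_attach_pendants:
  fixes G :: "'a ugraph"
  shows "adj (attach_pendants X G) (Inl u) (Inl v) \<longleftrightarrow> adj G u v"
  "adj (attach_pendants X G) (Inl u) (Inr v) \<longleftrightarrow> u = v \<and> v \<in> X"
  "adj (attach_pendants X G) (Inr v) (Inl u) \<longleftrightarrow> u = v \<and> v \<in> X"
  "\<not> adj (attach_pendants X G) (Inr u) (Inr v)"
proof -
  have "{Inl u, Inl v} = (Inl ` e :: ('a + 'a) set) \<longleftrightarrow> e = {u, v}" for e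
    using inj_image_eq_iff[of "Inl :: 'a \<Rightarrow> 'a + 'a" "{u, v}" e] by auto
  then show "adj (attach_pendants X G) (Inl u) (Inl v) \<longleftrightarrow> adj G u v"
    by (auto simp: adj_def attach_pendants_def)
  show "adj (attach_pendants X G) (Inl u) (Inr v) \<longleftrightarrow> u = v \<and> v \<in> X"
    by (auto simp: adj_def attach_pendants_def doubleton_eq_iff)
  then show "adj (attach_pendants X G) (Inr v) (Inl u) \<longleftrightarrow> u = v \<and> v \<in> X"
    by (simp add: adj_commute)
  show "\<not> adj (attach_pendants X G) (Inr u) (Inr v)"
    by (auto simp: adj_def attach_pendants_def doubleton_eq_iff)
qed

text \<open>Going back one step on the cycle is adding \<open>n - 1\<close> modulo \<open>n\<close>,
  with no case split at 0. In \<open>cycle_graph_dominating_card\<close> this presents the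
  predecessors of a set as an image of it.\<close>

lemma pred_mod_eq:
  fixes n v :: nat
  assumes "v < n"
  shows "(Suc v mod n + (n - 1)) mod n = v"
proof -
  have "(Suc v mod n + (n - 1)) mod n = (Suc v + (n - 1)) mod n"
    by (rule mod_add_left_eq)
  also have "Suc v + (n - 1) = v + n" using assms by simp
  finally show ?thesis using assms by simp
qed

section \<open>Degrees in the constructions\<close>

lemma degree_cycle_graph_ge:
  assumes "n \<ge> 3" "v < n"
  shows "degree (cycle_graph n) v \<ge> 2"
proof -
  \<comment> \<open>The cyclic predecessor of \<open>v\<close>; from \<open>n \<ge> 3\<close> on it
    differs from the successor.\<close>
  define p where "p = (if v = 0 then n - 1 else v - 1)"
  have "Suc v mod n \<noteq> p" using assms by (cases "Suc v = n") (auto simp: p_def)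
  then have "card {Suc v mod n, p} = 2" by simp
  moreover have "p < n" "Suc p mod n = v" using assms by (auto simp: p_def)
  then have "{Suc v mod n, p} \<subseteq> {u \<in> verts (cycle_graph n). adj (cycle_graph n) v u}"
    using assms by (auto simp: adj_cycle_graph verts_cycle_graph)
  moreover have "finite {u \<in> verts (cycle_graph n). adj (cycle_graph n) v u}"
    by (simp add: verts_cycle_graph)
  ultimately show ?thesis
    unfolding degree_def by (metis card_mono)
qed

lemma degree_graph_disjoint_union:
  assumes "i \<in> I"
  shows "degree (graph_disjoint_union I H) (i, u) = degree (H i) u"
proof -
  have "{x \<in> verts (graph_disjoint_union I H). adj (graph_disjoint_union I H) (i, u) x}
      = Pair i ` {v \<in> verts (H i). adj (H i) u v}"
    using assms by (auto simp: adj_graph_disjoint_union verts_graph_disjoint_union)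
  then show ?thesis
    by (simp add: degree_def card_image inj_on_def)
qed

lemma degree_add_vertex_Some:
  assumes "finite (verts G)"
  shows "degree (add_vertex X G) (Some u) = degree G u + (if u \<in> X then 1 else 0)"
proof -
  have "{x \<in> verts (add_vertex X G). adj (add_vertex X G) (Some u) x}
      = Some ` {v \<in> verts G. adj G u v} \<union> (if u \<in> X then {None} else {})"
    by (auto simp: adj_add_vertex verts_add_vertex)
  then show ?thesis
    using assms by (simp add: degree_def card_image)
qed

lemma degree_add_vertex_None:
  assumes "X \<subseteq> verts G"
  shows "degree (add_vertex X G) None = card X"
proof -
  have "{x \<in> verts (add_vertex X G). adj (add_vertex X G) None x} = Some ` X"
    using assms by (auto simp: adj_add_vertex verts_add_vertex)
  then show ?thesis
    by (simp add: degree_def card_image)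
qed

lemma degree_attach_pendants_Inl:
  assumes "finite (verts G)"
  shows "degree (attach_pendants X G) (Inl u) = degree G u + (if u \<in> X then 1 else 0)"
proof -
  have "{x \<in> verts (attach_pendants X G). adj (attach_pendants X G) (Inl u) x}
      = Inl ` {v \<in> verts G. adj G u v} \<union> (if u \<in> X then {Inr u} else {})"
    by (auto simp: adj_attach_pendants verts_attach_pendants)
  then show ?thesis
    using assms by (auto simp: degree_def card_image card_insert_if)
qed

lemma degree_attach_pendants_Inr:
  assumes "X \<subseteq> verts G" "v \<in> X"
  shows "degree (attach_pendants X G) (Inr v) = 1"
proof -
  have "{x \<in> verts (attach_pendants X G). adj (attach_pendants X G) (Inr v) x} = {Inl v}"
    using assms by (auto simp: adj_attach_pendants verts_attach_pendants)
  then show ?thesis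
    by (simp add: degree_def)
qed

section \<open>Edge counts\<close>

lemma finite_edges: "simple_graph G \<Longrightarrow> finite (edges G)"
  unfolding simple_graph_def by (rule finite_subset[of _ "Pow (verts G)"]) auto

text \<open>Edge numbers are only bounded from above here and below: they enter
  \<open>annihilation_number_le\<close> on the larger side, and edge sets can then be counted as
  images without checking injectivity.\<close>

lemma num_edges_cycle_graph_le: "num_edges (cycle_graph n) \<le> n"
proof -
  have "edges (cycle_graph n) = (\<lambda>j. {j, Suc j mod n}) ` {..<n}"
    by (auto simp: cycle_graph_def)
  then show ?thesis
    unfolding num_edges_def by (metis card_image_le card_lessThan finite_lessThan)
qed

lemma num_edges_graph_disjoint_union_le:
  assumes "finite I" "\<And>i. i \<in> I \<Longrightarrow> simple_graph (H i)"
  shows "num_edges (graph_disjoint_union I H) \<le> (\<Sum>i\<in>I. num_edges (H i))"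
proof -
  have "num_edges (graph_disjoint_union I H) = card (\<Union>i\<in>I. image (Pair i) ` edges (H i))"
    by (simp add: num_edges_def graph_disjoint_union_def setcompr_eq_image)
  also have "\<dots> \<le> (\<Sum>i\<in>I. card (image (Pair i) ` edges (H i)))"
    using assms(1) by (rule card_UN_le)
  also have "\<dots> \<le> (\<Sum>i\<in>I. num_edges (H i))"
    unfolding num_edges_def using assms by (intro sum_mono card_image_le finite_edges)
  finally show ?thesis .
qed

lemma num_edges_add_vertex_le:
  assumes "simple_graph G" "finite X"
  shows "num_edges (add_vertex X G) \<le> num_edges G + card X"
proof -
  have "num_edges (add_vertex X G) = card (image Some ` edges G \<union> (\<lambda>x. {None, Some x}) ` X)"
    by (simp add: num_edges_def add_vertex_def setcompr_eq_image)
  also have "\<dots> \<le> card (image Some ` edges G) + card ((\<lambda>x. {None, Some x}) ` X)"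
    by (rule card_Un_le)
  also have "\<dots> \<le> num_edges G + card X"
    unfolding num_edges_def using assms by (intro add_mono card_image_le finite_edges)
  finally show ?thesis .
qed

lemma num_edges_attach_pendants_le:
  assumes "simple_graph G" "finite X"
  shows "num_edges (attach_pendants X G) \<le> num_edges G + card X"
proof -
  have "num_edges (attach_pendants X G)
      = card (image Inl ` edges G \<union> (\<lambda>x. {Inl x, Inr x}) ` X)"
    by (simp add: num_edges_def attach_pendants_def setcompr_eq_image)
  also have "\<dots> \<le> card (image Inl ` edges G :: ('a + 'a) set set)
      + card ((\<lambda>x. {Inl x, Inr x}) ` X)"
    by (rule card_Un_le)
  also have "\<dots> \<le> num_edges G + card X"
    unfolding num_edges_def using assms by (intro add_mono card_image_le finite_edges)
  finally show ?thesis .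
qed

section \<open>Bounding the annihilation number from above\<close>

lemma sum_list_ge_of_few_small:
  fixes xs :: "nat list"
  assumes "\<And>x. x \<in> set xs \<Longrightarrow> x \<ge> 1"
  shows "3 * length xs \<le> sum_list xs + 2 * length (filter (\<lambda>x. x < 3) xs)"
  using assms
proof (induction xs)
  case (Cons x xs)
  then have "3 * length xs \<le> sum_list xs + 2 * length (filter (\<lambda>x. x < 3) xs)" "x \<ge> 1"
    by simp_all
  \<comment> \<open>A new entry falls short of 3 only if it is counted by the filter, and then by at
    most 2 because it is at least 1.\<close>
  then show ?case by auto
qed simp

text \<open>The \<open>a\<close> smallest degrees sum to at most the number of edges. Each would
  contribute 3 to this sum but for the small ones, which are missing at most 2 each, and a prefix
  contains no more small degrees than the whole sequence.\<close>

lemma annihilation_number_le: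
  assumes "finite (verts G)" "\<And>v. v \<in> verts G \<Longrightarrow> degree G v \<ge> 1"
  shows "3 * annihilation_number G \<le> num_edges G + 2 * card {v \<in> verts G. degree G v < 3}"
proof -
  define ds where "ds = degree_sequence G"
  have mset_ds: "mset ds = image_mset (degree G) (mset_set (verts G))"
    by (simp add: ds_def degree_sequence_def)
  have "set ds = degree G ` verts G"
    using mset_ds assms(1) by (metis finite_set_mset_mset_set set_image_mset set_mset_mset)
  then have pos: "\<And>x. x \<in> set ds \<Longrightarrow> x \<ge> 1" using assms(2) by auto
  have "length (filter (\<lambda>x. x < 3) ds) = size (filter_mset (\<lambda>x. x < 3) (mset ds))"
    by (metis mset_filter size_mset)
  also have "\<dots> = card {v \<in> verts G. degree G v < 3}"
    using assms(1) by (simp add: mset_ds filter_mset_image_mset)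
  finally have small: "length (filter (\<lambda>x. x < 3) ds) = card {v \<in> verts G. degree G v < 3}" .
  let ?A = "{k. k \<le> length ds \<and> sum_list (take k ds) \<le> num_edges G}"
  have "finite ?A" by (rule finite_subset[of _ "{..length ds}"]) auto
  \<comment> \<open>The set is nonempty and finite, so \<open>Max\<close> is attained.\<close>
  moreover have "0 \<in> ?A" by simp
  ultimately have "Max ?A \<in> ?A" by (intro Max_in) auto
  moreover define a where "a = annihilation_number G"
  ultimately have a: "a \<le> length ds" "sum_list (take a ds) \<le> num_edges G"
    unfolding annihilation_number_def ds_def by auto
  have "3 * a = 3 * length (take a ds)" using a by simp
  also have "\<dots> \<le> sum_list (take a ds) + 2 * length (filter (\<lambda>x. x < 3) (take a ds))"
    using pos by (intro sum_list_ge_of_few_small) (auto dest: in_set_takeD)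
  also have "length (filter (\<lambda>x. x < 3) (take a ds)) \<le> length (filter (\<lambda>x. x < 3) ds)"
    by (metis append_take_drop_id filter_append le_add1 length_append)
  finally show ?thesis using a small by (simp add: a_def)
qed

section \<open>Bounding domination from below\<close>

lemma two_domination_number_ge:
  assumes "finite (verts G)" "\<And>S. two_dominating G S \<Longrightarrow> card S \<ge> b"
  shows "two_domination_number G \<ge> b"
proof -
  have "finite {S. two_dominating G S}"
    by (rule finite_subset[of _ "Pow (verts G)"]) (use assms(1) in \<open>auto simp: two_dominating_def\<close>)
  \<comment> \<open>The whole vertex set shows that the \<open>Min\<close> is taken over a nonempty
    family.\<close>
  moreover have "two_dominating G (verts G)"
    by (simp add: two_dominating_def)
  ultimately show ?thesis
    unfolding two_domination_number_def using assms(2) by (subst Min_ge_iff) auto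
qed

text \<open>A vertex dominates only itself, its successor and its predecessor, so the cycle is
  covered by \<open>D\<close> and two images of \<open>D\<close>.\<close>

lemma cycle_graph_dominating_card:
  assumes "D \<subseteq> {..<n}" "\<And>v. v < n \<Longrightarrow> v \<in> D \<or> (\<exists>u\<in>D. adj (cycle_graph n) v u)"
  shows "n \<le> 3 * card D"
proof -
  have fin: "finite D" using assms(1) finite_subset by blast
  have "{..<n} \<subseteq> D \<union> (\<lambda>d. Suc d mod n) ` D \<union> (\<lambda>d. (d + (n - 1)) mod n) ` D"
  proof
    fix v assume "v \<in> {..<n}"
    then have v: "v < n" by simp
    from assms(2)[OF v] consider "v \<in> D" | u where "u \<in> D" "v = Suc u mod n"
      | "Suc v mod n \<in> D"
      by (auto simp: adj_cycle_graph)
    then show "v \<in> D \<union> (\<lambda>d. Suc d mod n) ` D \<union> (\<lambda>d. (d + (n - 1)) mod n) ` D"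
    proof cases
      case 3
      then have "(Suc v mod n + (n - 1)) mod n \<in> (\<lambda>d. (d + (n - 1)) mod n) ` D"
        by (rule imageI)
      then show ?thesis using pred_mod_eq[OF v] by simp
    qed auto
  qed
  then have "card {..<n} \<le> card (D \<union> (\<lambda>d. Suc d mod n) ` D \<union> (\<lambda>d. (d + (n - 1)) mod n) ` D)"
    using fin by (intro card_mono) auto
  also have "\<dots> \<le> card D + card ((\<lambda>d. Suc d mod n) ` D) + card ((\<lambda>d. (d + (n - 1)) mod n) ` D)"
    by (meson add_le_mono1 card_Un_le order_trans)
  also have "\<dots> \<le> card D + card D + card D"
    using fin by (intro add_mono card_image_le) auto
  finally show ?thesis by simp
qed

section \<open>The graph built from the cycles \<open>C_(3k_i+1)\<close>\<close>

theorem theorem2p1: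
  fixes c\<^sub>0 t :: nat and k r :: "nat \<Rightarrow> nat"
  assumes "c\<^sub>0 > 0"
    and "t \<ge> 4"
    and "\<And>i. i \<in> {1..t} \<Longrightarrow> k i \<ge> 1"
    and "\<And>i. i \<in> {1..t} \<Longrightarrow> r i \<in> verts (cycle_graph (3 * k i + 1))"
    and "t > 3 * (c\<^sub>0 + 1)"
  shows "int (two_domination_number (pendant_cycles_graph t k r))
           - int (annihilation_number (pendant_cycles_graph t k r)) > int c\<^sub>0 + 1"
proof -
  \<comment> \<open>\<open>J\<close> is the graph before pendants are attached, \<open>None\<close>
    in it is \<open>w\<close>, and \<open>R\<close> holds the cycle vertices joined to
    \<open>w\<close>. The number L of pendant vertices is \<open>card X\<close>, which is never
    evaluated.\<close>
  define n where "n i = 3 * k i + 1" for i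
  define U where "U = graph_disjoint_union {1..t} (\<lambda>i. cycle_graph (n i))"
  define R where "R = {(i, r i) | i. i \<in> {1..t}}"
  define J where "J = joined_cycles t k r"
  define X where "X = {v \<in> verts J. degree J v = 2}"
  define P where "P = pendant_cycles_graph t k r"
  define K where "K = (\<Sum>i\<in>{1..t}. k i)"
  have J: "J = add_vertex R U"
    by (simp add: J_def joined_cycles_def R_def U_def n_def)
  have P: "P = attach_pendants X J"
    by (simp add: P_def pendant_cycles_graph_def X_def J_def)
  have n3: "n i \<ge> 3" if "i \<in> {1..t}" for i
    using assms(3)[OF that] by (simp add: n_def)
  have vU: "verts U = (SIGMA i:{1..t}. {..<n i})"
    by (simp add: U_def verts_graph_disjoint_union verts_cycle_graph)
  have vJ: "verts J = insert None (Some ` verts U)"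
    by (simp add: J verts_add_vertex)
  have vP: "verts P = Inl ` verts J \<union> Inr ` X"
    by (simp add: P verts_attach_pendants)
  have R: "R \<subseteq> verts U"
    using assms(4) by (auto simp: R_def vU n_def verts_cycle_graph)
  have "R = (\<lambda>i. (i, r i)) ` {1..t}" by (auto simp: R_def)
  then have card_R: "card R = t" by (simp add: card_image inj_on_def)
  have sC: "simple_graph (cycle_graph (n i))" if "i \<in> {1..t}" for i
    using n3[OF that] by (rule simple_graph_cycle_graph)
  then have sU: "simple_graph U"
    unfolding U_def by (intro simple_graph_disjoint_union) simp_all
  then have sJ: "simple_graph J"
    unfolding J using R by (rule simple_graph_add_vertex)
  have X: "X \<subseteq> verts J" by (auto simp: X_def)
  with sJ have sP: "simple_graph P"
    unfolding P by (rule simple_graph_attach_pendants)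
  have fin: "finite (verts U)" "finite (verts J)" "finite (verts P)" "finite X" "finite R"
    using sU sJ sP X R finite_subset by (auto simp: simple_graph_def)

  have degU: "degree U x \<ge> 2" if xU: "x \<in> verts U" for x
  proof -
    obtain i u where x: "x = (i, u)" "i \<in> {1..t}" "u < n i" using xU by (auto simp: vU)
    then have "degree U x = degree (cycle_graph (n i)) u"
      unfolding U_def by (simp add: degree_graph_disjoint_union)
    then show ?thesis using degree_cycle_graph_ge[OF n3[OF x(2)] x(3)] by simp
  qed
  have degJ: "degree J v \<ge> 2" if "v \<in> verts J" for v
  proof (cases v)
    case None
    then show ?thesis using degree_add_vertex_None[OF R] card_R assms(2) by (simp add: J)
  next
    case (Some x)
    then show ?thesis
      using that degU[of x] degree_add_vertex_Some[OF fin(1), of R x] by (auto simp: vJ J[symmetric])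
  qed
  \<comment> \<open>A cycle vertex joined to \<open>w\<close> already has degree at least 3 in
    \<open>J\<close>. So no cycle vertex has both \<open>w\<close> and a pendant as
    neighbours.\<close>
  have root_notin_X: "Some x \<notin> X" if "x \<in> R" for x
    using that degU[of x] R degree_add_vertex_Some[OF fin(1), of R x]
    by (auto simp: X_def J[symmetric])
  \<comment> \<open>Vertices of degree exactly 2 in \<open>J\<close> gain a pendant neighbour; all
    others have degree at least 3 already.\<close>
  have degP: "degree P (Inl v) \<ge> 3" if "v \<in> verts J" for v
    using degJ[OF that] that degree_attach_pendants_Inl[OF fin(2), of X v, folded P]
    by (auto simp: X_def split: if_splits)
  have degP': "degree P (Inr v) = 1" if "v \<in> X" for v
    unfolding P using X that by (rule degree_attach_pendants_Inr)

  \<comment> \<open>The cycles give 3K + t edges, \<open>w\<close> gives t, and the pendants give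
    L.\<close>
  have "num_edges U \<le> (\<Sum>i\<in>{1..t}. num_edges (cycle_graph (n i)))"
    unfolding U_def using sC by (intro num_edges_graph_disjoint_union_le) auto
  also have "\<dots> \<le> (\<Sum>i\<in>{1..t}. n i)"
    by (intro sum_mono num_edges_cycle_graph_le)
  also have "\<dots> = 3 * K + t"
    by (simp add: n_def K_def sum_Suc sum_distrib_left)
  finally have "num_edges U \<le> 3 * K + t" .
  moreover have "num_edges J \<le> num_edges U + t"
    unfolding J using num_edges_add_vertex_le[OF sU fin(5)] card_R by simp
  moreover have "num_edges P \<le> num_edges J + card X"
    unfolding P using sJ fin(4) by (rule num_edges_attach_pendants_le)
  ultimately have m: "num_edges P \<le> 3 * K + 2 * t + card X" by simp

  have "{v \<in> verts P. degree P v < 3} \<subseteq> Inr ` X"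
    using degP by (force simp: vP)
  with fin(4) have "card {v \<in> verts P. degree P v < 3} \<le> card X"
    by (rule surj_card_le)
  moreover have "3 * annihilation_number P \<le> num_edges P + 2 * card {v \<in> verts P. degree P v < 3}"
  proof (rule annihilation_number_le[OF fin(3)])
    fix v assume "v \<in> verts P"
    then show "1 \<le> degree P v"
      using degP degP' by (cases v) (force simp: vP)+
  qed
  ultimately have a: "3 * annihilation_number P \<le> 3 * K + 2 * t + 3 * card X"
    using m by simp

  have "two_domination_number P \<ge> card X + (K + t)"
  proof (rule two_domination_number_ge)
    fix S assume S: "two_dominating P S"
    then have SP: "S \<subseteq> verts P" and dom: "\<And>v. v \<in> verts P \<Longrightarrow> v \<notin> S \<Longrightarrow> card {u \<in> S. adj P v u} \<ge> 2"
      by (auto simp: two_dominating_def)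
    have leaves: "Inr ` X \<subseteq> S"
    proof (rule ccontr)
      \<comment> \<open>A pendant vertex outside \<open>S\<close> would need two neighbours in
        \<open>S\<close>, but it has degree 1.\<close>
      assume "\<not> Inr ` X \<subseteq> S"
      then obtain v where v: "v \<in> X" "Inr v \<notin> S" by auto
      then have "2 \<le> card {u \<in> S. adj P (Inr v) u}" by (intro dom) (auto simp: vP)
      also have "\<dots> \<le> degree P (Inr v)"
        unfolding degree_def using SP fin by (intro card_mono) auto
      finally show False using degP'[OF v(1)] by simp
    qed
    \<comment> \<open>The trace of \<open>S\<close> on the \<open>i\<close>-th cycle, in that
      cycle's own labels.\<close>
    define D where "D i = {u. u < n i \<and> Inl (Some (i, u)) \<in> S}" for i
    have D: "k i + 1 \<le> card (D i)" if i: "i \<in> {1..t}" for i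
    proof -
      have "n i \<le> 3 * card (D i)"
      proof (rule cycle_graph_dominating_card)
        fix v assume v: "v < n i"
        show "v \<in> D i \<or> (\<exists>u\<in>D i. adj (cycle_graph (n i)) v u)"
        proof (rule ccontr)
          assume neg: "\<not> ?thesis"
          then have "2 \<le> card {u \<in> S. adj P (Inl (Some (i, v))) u}"
            using v i by (intro dom) (auto simp: D_def vP vJ vU)
          \<comment> \<open>If \<open>S\<close> neither contains \<open>v\<close> nor meets its
            neighbours on the cycle, any neighbour in \<open>S\<close> lies off the cycle. That can
            only be \<open>w\<close> for a vertex in \<open>R\<close>, and only the pendant
            otherwise: one candidate where two neighbours are demanded.\<close>
          moreover have "{u \<in> S. adj P (Inl (Some (i, v))) u}
              \<subseteq> {if (i, v) \<in> R then Inl None else Inr (Some (i, v))}"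
          proof
            fix u assume "u \<in> {u \<in> S. adj P (Inl (Some (i, v))) u}"
            then have u: "u \<in> S" "adj P (Inl (Some (i, v))) u" by auto
            consider x where "u = Inr x" | "u = Inl None" | j y where "u = Inl (Some (j, y))"
              by (metis old.sum.exhaust option.exhaust surj_pair)
            then show "u \<in> {if (i, v) \<in> R then Inl None else Inr (Some (i, v))}"
            proof cases
              case 1
              then show ?thesis using u root_notin_X by (auto simp: P adj_attach_pendants)
            next
              case 2
              then show ?thesis using u by (simp add: P J adj_attach_pendants adj_add_vertex)
            next
              case 3
              then have "j = i" "adj (cycle_graph (n i)) v y"
                using u by (auto simp: P J U_def adj_attach_pendants adj_add_vertex
                    adj_graph_disjoint_union)
              moreover have "y < n i"
                using u(1) SP 3 \<open>j = i\<close> by (auto simp: vP vJ vU)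
              ultimately show ?thesis using neg u(1) 3 by (auto simp: D_def)
            qed
          qed
          from card_mono[OF _ this] have "card {u \<in> S. adj P (Inl (Some (i, v))) u} \<le> 1"
            by simp
          ultimately show False by simp
        qed
      qed (auto simp: D_def)
      \<comment> \<open>From 3k + 1 <= 3d for an integer d follows d >= k + 1; the extra vertex
        beyond 3k produces the term t in the bound.\<close>
      then show ?thesis by (simp add: n_def)
    qed
    have finD: "finite (D i)" for i by (simp add: D_def)
    \<comment> \<open>Pendants and cycle vertices of \<open>S\<close> are disjoint parts of it;
      \<open>w\<close> may belong to \<open>S\<close> as well but is left out of the count.\<close>
    let ?C = "(\<lambda>x. Inl (Some x)) ` (SIGMA i:{1..t}. D i) :: ((nat \<times> nat) option + (nat \<times> nat) option) set"
    let ?L = "Inr ` X :: ((nat \<times> nat) option + (nat \<times> nat) option) set"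
    have "K + t = (\<Sum>i\<in>{1..t}. k i + 1)" by (simp add: K_def sum_Suc)
    also have "\<dots> \<le> (\<Sum>i\<in>{1..t}. card (D i))" by (intro sum_mono D)
    also have "\<dots> = card (SIGMA i:{1..t}. D i)" using finD by simp
    also have "\<dots> = card ?C" by (simp add: card_image inj_on_def)
    finally have "card X + (K + t) \<le> card ?L + card ?C" by (simp add: card_image)
    also have "\<dots> = card (?L \<union> ?C)"
      using fin finD by (intro card_Un_disjoint[symmetric]) auto
    also have "\<dots> \<le> card S"
      using leaves finite_subset[OF SP fin(3)] by (intro card_mono) (auto simp: D_def)
    finally show "card X + (K + t) \<le> card S" .
  qed (rule fin(3))
  \<comment> \<open>Tripling the lower bound cancels K and L against the bound \<open>a\<close>,
    leaving a difference of t, which exceeds \<open>3 * (c\<^sub>0 + 1)\<close>.\<close>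
  then show ?thesis using a assms(5) by (simp add: P_def)
qed

end
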